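(* Let $f:\mathbb{R}^{n\times p}\to\mathbb{R}$ be locally Lipschitz continuous. For any $\beta>0$, any $r\in\left(0,\frac{\beta}{2\beta+8M_1}\right)$ and any $X\in\Omega_r$, it holds that $$\mathrm{dist}(0,\partial h(X))\ \ge\ \frac{\beta}{4}\,\|X^\top X-I_p\|_{\mathrm F}.$$ Furthermore, if $X^*\in\Omega_r$ is a first-order stationary point of $h$ (that is, $0\in\partial h(X^* )$), then $X^*$ is a first-order stationary point of the problem $\min\{f(X): X\in\mathbb{R}^{n\times p},\ X^\top X=I_p\}$.
   Context: $\|\cdot\|_{\mathrm F}$ is the Frobenius norm, $\langle X,Y\rangle=\mathrm{tr}(X^\top Y)$, and $\mathrm{dist}(0,S)=\inf_{D\in S}\|D\|_{\mathrm F}$. $\partial$ denotes the Clarke subdifferential of a locally Lipschitz function. $\mathcal{S}_{n,p}=\{X\in\mathbb{R}^{n\times p}:X^\top X=I_p\}$ and, for $r>0$, $\Omega_r=\{X\in\mathbb{R}^{n\times p}:\|X^\top X-I_p\|_{\mathrm F}\le r\}$. $\Phi(M)=\frac12(M+M^\top)$. $\mathcal{A}:\mathbb{R}^{n\times p}\to\mathbb{R}^{n\times p}$ is $\mathcal{A}(X)=\frac18X\left(15I_p-10X^\top X+3(X^\top X)^2\right)$, and for a penalty parameter $\beta>0$, $h(X)=f(\mathcal{A}(X))+\frac{\beta}{4}\|X^\top X-I_p\|_{\mathrm F}^2$. $M_1=\sup\{\|W\|_{\mathrm F}: X\in\Omega_1,\ W\in\partial f(X)\}$. A point $X$ is a first-order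 stationary point of $\min\{f(X):X^\top X=I_p\}$ if $X\in\mathcal{S}_{n,p}$ and $0\in\{W-X\Phi(X^\top W): W\in\partial f(X)\}$. *)

theory Defs
  imports "HOL-Analysis.Analysis"
begin

text \<open>
  An $n \times p$ matrix is an element of \<^typ>\<open>real^'p^'n\<close>.  On this type the library's inner
  product and norm are the trace inner product and the Frobenius norm:
\<close>

lemma inner_eq_trace:
  fixes X Y :: "real^'p^'n"
  shows "X \<bullet> Y = trace (transpose X ** Y)"
  unfolding inner_vec_def trace_def matrix_matrix_mult_def transpose_def
  by (simp add: sum.swap[of _ "UNIV :: 'n set"])

lemma norm_eq_frobenius:
  fixes X :: "real^'p^'n"
  shows "norm X = sqrt (\<Sum>i\<in>UNIV. \<Sum>j\<in>UNIV. (X $ i $ j)\<^sup>2)"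
  by (simp add: norm_eq_sqrt_inner inner_vec_def power2_eq_square)

definition locally_lipschitz :: "('a::metric_space \<Rightarrow> 'b::metric_space) \<Rightarrow> bool" where
  "locally_lipschitz f \<longleftrightarrow> (\<forall>x. \<exists>e>0. \<exists>L. L-lipschitz_on (ball x e) f)"

text \<open>
  Clarke's generalized directional derivative, the upper limit of $(f(y + tv) - f(y))/t$ as
  $y \to x$ (with $y = x$ allowed) and $t \downarrow 0$.
\<close>

definition clarke_dir_deriv :: "('a::real_normed_vector \<Rightarrow> real) \<Rightarrow> 'a \<Rightarrow> 'a \<Rightarrow> ereal" where
  "clarke_dir_deriv f x v =
     Limsup (nhds x \<times>\<^sub>F at_right 0) (\<lambda>(y, t). ereal ((f (y + t *\<^sub>R v) - f y) / t))"

definition clarke_subdiff :: "('a::real_inner \<Rightarrow> real) \<Rightarrow> 'a \<Rightarrow> 'a set" where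
  "clarke_subdiff f x = {w. \<forall>v. ereal (w \<bullet> v) \<le> clarke_dir_deriv f x v}"

definition stiefel :: "(real^'p^'n) set" where
  "stiefel = {X. transpose X ** X = mat 1}"

definition Omega :: "real \<Rightarrow> (real^'p^'n) set" where
  "Omega r = {X. norm (transpose X ** X - mat 1) \<le> r}"

definition sym_part :: "real^'p^'p \<Rightarrow> real^'p^'p" where
  "sym_part M = (1/2) *\<^sub>R (M + transpose M)"

definition dissolve :: "real^'p^'n \<Rightarrow> real^'p^'n" where
  "dissolve X = (1/8) *\<^sub>R (X **
     (15 *\<^sub>R mat 1 - 10 *\<^sub>R (transpose X ** X)
      + 3 *\<^sub>R ((transpose X ** X) ** (transpose X ** X))))"

definition penalty :: "(real^'p^'n \<Rightarrow> real) \<Rightarrow> real \<Rightarrow> real^'p^'n \<Rightarrow> real" where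
  "penalty f \<beta> X = f (dissolve X) + \<beta> / 4 * (norm (transpose X ** X - mat 1))\<^sup>2"

text \<open>
  The constant $M_1$.  Being a supremum of norms it is taken in $[0, \infty)$; inserting $0$ only
  matters when \<^term>\<open>Omega 1\<close> is empty (which happens iff $p \ge n + 2$), where the real
  supremum of the empty set would be unspecified.
\<close>

definition subgrad_bound :: "(real^'p^'n \<Rightarrow> real) \<Rightarrow> real" where
  "subgrad_bound f = Sup (insert 0 {norm W | X W. X \<in> Omega 1 \<and> W \<in> clarke_subdiff f X})"

lemma subgrad_bound_eq_Sup:
  assumes "{norm W | X W. X \<in> Omega 1 \<and> W \<in> clarke_subdiff f X} \<noteq> {}" (is "?S \<noteq> {}")
    and "bdd_above {norm W | X W. X \<in> Omega 1 \<and> W \<in> clarke_subdiff f X}"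
  shows "subgrad_bound f = Sup {norm W | X W. X \<in> Omega 1 \<and> W \<in> clarke_subdiff f X}"
proof -
  obtain s where s: "s \<in> ?S" using assms(1) by blast
  then have "0 \<le> s" by auto
  also have "s \<le> Sup ?S" using s assms(2) by (rule cSup_upper)
  finally have "0 \<le> Sup ?S" .
  moreover have "Sup (insert 0 ?S) = sup 0 (Sup ?S)"
    using assms by (rule cSup_insert)
  ultimately show ?thesis
    unfolding subgrad_bound_def by (simp add: sup_absorb2)
qed

definition stationary_stiefel :: "(real^'p^'n \<Rightarrow> real) \<Rightarrow> real^'p^'n \<Rightarrow> bool" where
  "stationary_stiefel f X \<longleftrightarrow> X \<in> stiefel \<and>
     0 \<in> {W - X ** sym_part (transpose X ** W) | W. W \<in> clarke_subdiff f X}"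

end

theory Submission
  imports Defs
begin

text \<open>
  Write $E = X^\top X - I$.  The penalty function has the generalized directional derivative
  $h^\circ(X; V) \le f^\circ(\mathcal{A}(X); D\mathcal{A}(X)[V]) + \beta \langle XE, V\rangle$.
  On the singular values, $\mathcal{A}$ acts as $x \mapsto x(15 - 10x^2 + 3x^4)/8$, whose derivative
  is $\frac{15}{8}(x^2-1)^2$; hence $D\mathcal{A}(X)[XE] = \frac{15}{8} XE^3$ is of third order in
  $E$.  Testing a subgradient with $V = -XE$ therefore makes the penalty term dominate, which gives
  the distance bound.  The bound forces $E = 0$ at a stationary point, and there $D\mathcal{A}(X)$ is
  the orthogonal projection $P$ onto the tangent space, so $f^\circ(X; \cdot) \ge 0$ on the range of
  $P$; a Hahn-Banach argument yields $W \in \partial f(X)$ orthogonal to that range, i.e. $PW = 0$.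
\<close>

section \<open>Clarke directional derivatives and subgradients\<close>

text \<open>Hahn-Banach in finite dimension: the zero functional on \<open>L\<close>, dominated
  there by \<open>p\<close>, extends to the whole space. Applied to \<open>p\<close> minus a linear
  functional it extends any dominated functional from \<open>L\<close>.\<close>

lemma sublinear_minorant_vanishing_on_subspace:
  fixes p :: "'a::euclidean_space \<Rightarrow> real"
  assumes add: "\<And>v w. p (v + w) \<le> p v + p w"
    and scale: "\<And>s v. s \<ge> 0 \<Longrightarrow> p (s *\<^sub>R v) \<le> s * p v"
    and L: "subspace L" and nonneg: "\<And>u. u \<in> L \<Longrightarrow> p u \<ge> 0"
  obtains w where "\<And>v. w \<bullet> v \<le> p v" "\<And>u. u \<in> L \<Longrightarrow> w \<bullet> u = 0"
proof -
  \<comment> \<open>Separate the strict epigraph of \<open>p\<close> from \<open>L \<times> {0}\<close>.\<close>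
  define S where "S = L \<times> {0::real}"
  define T where "T = {z. p (fst z) < snd z}"
  have "convex S"
    unfolding S_def using L by (intro convex_Times) (auto simp: subspace_imp_convex)
  moreover have "convex T"
  proof (rule convexI)
    fix x y and a b :: real
    assume xy: "x \<in> T" "y \<in> T" and ab: "0 \<le> a" "0 \<le> b" "a + b = 1"
    have "p (a *\<^sub>R fst x + b *\<^sub>R fst y) \<le> a * p (fst x) + b * p (fst y)"
      using add[of "a *\<^sub>R fst x" "b *\<^sub>R fst y"] scale[OF ab(1), of "fst x"] scale[OF ab(2), of "fst y"]
      by linarith
    also have "\<dots> < a * snd x + b * snd y"
    proof (cases "a = 0")
      case False
      then have "a * p (fst x) < a * snd x" "b * p (fst y) \<le> b * snd y"
        using xy ab by (auto simp: T_def intro!: mult_left_mono)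
      then show ?thesis by linarith
    qed (use xy ab in \<open>auto simp: T_def\<close>)
    finally show "a *\<^sub>R x + b *\<^sub>R y \<in> T" by (simp add: T_def)
  qed
  moreover have "(0, 0) \<in> S" using L by (simp add: S_def subspace_0)
  moreover have "(0, p 0 + 1) \<in> T" by (simp add: T_def)
  moreover have "S \<inter> T = {}" using nonneg by (force simp: S_def T_def)
  ultimately obtain z b where z: "z \<noteq> 0" and zS: "\<And>x. x \<in> S \<Longrightarrow> z \<bullet> x \<le> b"
    and zT: "\<And>x. x \<in> T \<Longrightarrow> z \<bullet> x \<ge> b"
    using separating_hyperplane_sets[of S T] by blast
  obtain a s where as: "z = (a, s)" by (cases z)
  have b0: "b \<ge> 0" using zS[OF \<open>(0, 0) \<in> S\<close>] by (simp add: as)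
  have aL: "a \<bullet> u = 0" if "u \<in> L" for u
  proof (rule ccontr)
    assume ne: "a \<bullet> u \<noteq> 0"
    \<comment> \<open>The multiple of \<open>u\<close> is chosen so that its inner product with
      \<open>a\<close> is \<open>b + 1\<close>: a linear functional bounded above on a subspace
      vanishes there.\<close>
    have "(((b + 1) / (a \<bullet> u)) *\<^sub>R u, 0) \<in> S"
      using that L by (auto simp: S_def subspace_mul)
    from zS[OF this] show False using ne by (simp add: as)
  qed
  have aT: "a \<bullet> v + s * t \<ge> 0" if "t > p v" for v t
    using zT[of "(v, t)"] that b0 by (simp add: T_def as)
  have s0: "s \<ge> 0"
  proof (rule ccontr)
    assume "\<not> s \<ge> 0"
    moreover have "a \<bullet> 0 + s * (\<bar>p 0\<bar> + 1) \<ge> 0" by (rule aT) linarith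
    ultimately show False by (auto simp: zero_le_mult_iff)
  qed
  \<comment> \<open>The hyperplane is not vertical: for \<open>s = 0\<close> the test point
    \<open>- a\<close> forces \<open>a = 0\<close>, hence \<open>z = 0\<close>.\<close>
  have "s \<noteq> 0"
  proof
    assume "s = 0"
    then have "a \<bullet> (- a) \<ge> 0" using aT[of "- a" "p (- a) + 1"] by simp
    then have "a \<bullet> a = 0" using inner_ge_zero[of a] by (simp add: antisym)
    then have "a = 0" by simp
    with z \<open>s = 0\<close> show False by (simp add: as zero_prod_def)
  qed
  with s0 have s: "s > 0" by simp
  show ?thesis
  proof (rule that[of "(- (1 / s)) *\<^sub>R a"])
    fix v
    have "- (a \<bullet> v) / s \<le> p v"
    \<comment> \<open>\<open>T\<close> only contains heights strictly above \<open>p v\<close>, so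
      the value \<open>p v\<close> itself is reached as a limit.\<close>
    proof (rule dense_ge)
      fix t assume "p v < t"
      from aT[OF this] s show "- (a \<bullet> v) / s \<le> t" by (simp add: field_simps)
    qed
    then show "(- (1 / s)) *\<^sub>R a \<bullet> v \<le> p v" by simp
  qed (simp add: aL)
qed

text \<open>Trades the upper limit in \<open>ereal\<close> for eventual strict inequalities between
  reals, the form in which the estimates below are carried out. Among the bounds \<open>y\<close>
  above \<open>ereal c\<close>, infinity is trivial and minus infinity cannot occur.\<close>

lemma clarke_dir_deriv_le_iff:
  "clarke_dir_deriv f x v \<le> ereal c \<longleftrightarrow>
     (\<forall>e>c. \<forall>\<^sub>F z in nhds x \<times>\<^sub>F at_right 0.
        (f (fst z + snd z *\<^sub>R v) - f (fst z)) / snd z < e)" (is "?l \<longleftrightarrow> ?r")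
proof -
  have "?l \<longleftrightarrow> (\<forall>y>ereal c. \<forall>\<^sub>F z in nhds x \<times>\<^sub>F at_right 0.
        ereal ((f (fst z + snd z *\<^sub>R v) - f (fst z)) / snd z) < y)" (is "_ \<longleftrightarrow> ?m")
    by (simp add: clarke_dir_deriv_def Limsup_le_iff case_prod_beta)
  also have "\<dots> \<longleftrightarrow> ?r"
  proof
    assume ?m then show ?r by (metis (no_types, lifting) eventually_mono less_ereal.simps(1))
  next
    assume r: ?r
    show ?m
    proof (intro allI impI)
      fix y assume y: "ereal c < y"
      then show "\<forall>\<^sub>F z in nhds x \<times>\<^sub>F at_right 0.
          ereal ((f (fst z + snd z *\<^sub>R v) - f (fst z)) / snd z) < y"
        using r by (cases y) auto
    qed
  qed
  finally show ?thesis .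
qed

lemma tendsto_fst_prod_nhds: "(fst \<longlongrightarrow> x) (nhds x \<times>\<^sub>F G)"
  using filtermap_fst_prod_filter by (simp add: filterlim_def)

lemma filterlim_snd_prod: "filterlim snd G (F \<times>\<^sub>F G)"
  using filtermap_snd_prod_filter by (simp add: filterlim_def)

lemma tendsto_snd_prod_at_right: "(snd \<longlongrightarrow> (0::real)) (F \<times>\<^sub>F at_right 0)"
  using filterlim_snd_prod[of "at_right (0::real)" F] filterlim_at by blast

lemma eventually_snd_pos: "\<forall>\<^sub>F z in F \<times>\<^sub>F at_right (0::real). snd z > 0"
  using filterlim_snd_prod[of "at_right (0::real)" F] by (auto simp: filterlim_at elim: eventually_mono)

lemma tendsto_fst_plus_snd_scaleR:
  fixes x v :: "'a::real_normed_vector"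
  shows "((\<lambda>z. fst z + snd z *\<^sub>R v) \<longlongrightarrow> x) (nhds x \<times>\<^sub>F at_right 0)"
  using tendsto_add[OF tendsto_fst_prod_nhds tendsto_scaleR[OF tendsto_snd_prod_at_right tendsto_const]]
  by simp

text \<open>The increment along \<open>v + w\<close> is split at the moved base point
  \<open>y + t v\<close>. Since the pair \<open>(y + t v, t)\<close> tends to the same filter, the
  bound for \<open>w\<close> applies at that point; this is where the varying base point yields
  subadditivity.\<close>

lemma clarke_dir_deriv_add_le:
  assumes "clarke_dir_deriv f x v \<le> ereal a" "clarke_dir_deriv f x w \<le> ereal b"
  shows "clarke_dir_deriv f x (v + w) \<le> ereal (a + b)"
  unfolding clarke_dir_deriv_le_iff
proof (intro allI impI)
  fix e assume e: "e > a + b"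
  let ?F = "nhds x \<times>\<^sub>F at_right 0"
  define d where "d = (e - (a + b)) / 2"
  have d: "d > 0" using e by (simp add: d_def)
  have "filterlim (\<lambda>z. (fst z + snd z *\<^sub>R v, snd z)) ?F ?F"
    by (intro filterlim_Pair tendsto_fst_plus_snd_scaleR filterlim_snd_prod)
  moreover have "\<forall>\<^sub>F z in ?F. (f (fst z + snd z *\<^sub>R w) - f (fst z)) / snd z < b + d"
    using assms(2) d unfolding clarke_dir_deriv_le_iff by simp
  ultimately have "\<forall>\<^sub>F z in ?F. (f (fst z + snd z *\<^sub>R v + snd z *\<^sub>R w) - f (fst z + snd z *\<^sub>R v)) / snd z < b + d"
    by (auto dest: eventually_compose_filterlim)
  moreover have "\<forall>\<^sub>F z in ?F. (f (fst z + snd z *\<^sub>R v) - f (fst z)) / snd z < a + d"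
    using assms(1) d unfolding clarke_dir_deriv_le_iff by simp
  ultimately show "\<forall>\<^sub>F z in ?F. (f (fst z + snd z *\<^sub>R (v + w)) - f (fst z)) / snd z < e"
  proof eventually_elim
    case (elim z)
    have "a + d + (b + d) = e" by (simp add: d_def field_simps)
    with elim show ?case
      by (simp add: diff_divide_distrib scaleR_add_right add.assoc)
  qed
qed

lemma clarke_dir_deriv_zero: "clarke_dir_deriv f x 0 = 0"
proof -
  have "clarke_dir_deriv f x 0 = Limsup (nhds x \<times>\<^sub>F at_right (0::real)) (\<lambda>_. 0)"
    unfolding clarke_dir_deriv_def
    by (rule Limsup_eq, rule always_eventually) (auto simp: zero_ereal_def)
  also have "\<dots> = 0" by (rule Limsup_const) (simp add: prod_filter_eq_bot)
  finally show ?thesis .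
qed

text \<open>A positive factor \<open>s\<close> is absorbed by the substitution of
  \<open>s * t\<close> for the step \<open>t\<close>; \<open>s = 0\<close> is separate.\<close>

lemma clarke_dir_deriv_scaleR_le:
  assumes "clarke_dir_deriv f x v \<le> ereal a" "s \<ge> 0"
  shows "clarke_dir_deriv f x (s *\<^sub>R v) \<le> ereal (s * a)"
proof (cases "s = 0")
  case True
  then show ?thesis by (simp add: clarke_dir_deriv_zero)
next
  case False
  with assms have s: "s > 0" by simp
  let ?F = "nhds x \<times>\<^sub>F at_right 0"
  show ?thesis
    unfolding clarke_dir_deriv_le_iff
  proof (intro allI impI)
    fix e assume "e > s * a"
    then have "e / s > a" using s by (simp add: field_simps)
    then have "\<forall>\<^sub>F z in ?F. (f (fst z + snd z *\<^sub>R v) - f (fst z)) / snd z < e / s"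
      using assms(1) unfolding clarke_dir_deriv_le_iff by blast
    moreover have "filterlim (\<lambda>z. s * snd z) (at_right 0) ?F"
    proof -
      have "((\<lambda>z. s * snd z) \<longlongrightarrow> s * 0) ?F"
        by (intro tendsto_mult tendsto_const tendsto_snd_prod_at_right)
      then show ?thesis
        using eventually_snd_pos[of "nhds x"] s by (auto simp: filterlim_at elim: eventually_mono)
    qed
    then have "filterlim (\<lambda>z. (fst z, s * snd z)) ?F ?F"
      by (intro filterlim_Pair tendsto_fst_prod_nhds)
    ultimately have "\<forall>\<^sub>F z in ?F. (f (fst z + (s * snd z) *\<^sub>R v) - f (fst z)) / (s * snd z) < e / s"
      by (auto dest: eventually_compose_filterlim)
    then show "\<forall>\<^sub>F z in ?F. (f (fst z + snd z *\<^sub>R s *\<^sub>R v) - f (fst z)) / snd z < e"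
      using eventually_snd_pos[of "nhds x"]
    proof eventually_elim
      case (elim z)
      then have "s * ((f (fst z + (s * snd z) *\<^sub>R v) - f (fst z)) / (s * snd z)) < s * (e / s)"
        using s by (intro mult_strict_left_mono)
      then show ?case using s by (simp add: mult.commute)
    qed
  qed
qed

text \<open>The value $-\infty$ is excluded by subadditivity and $f^\circ(x; 0) = 0$.\<close>

lemma clarke_dir_deriv_finite:
  assumes "\<And>v. clarke_dir_deriv f x v < \<infinity>"
  shows "clarke_dir_deriv f x v = ereal (real_of_ereal (clarke_dir_deriv f x v))"
proof -
  have "clarke_dir_deriv f x v \<noteq> - \<infinity>"
  proof
    assume m: "clarke_dir_deriv f x v = - \<infinity>"
    obtain a where a: "clarke_dir_deriv f x (- v) \<le> ereal a"
      using assms[of "- v"] by (cases "clarke_dir_deriv f x (- v)") auto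
    \<comment> \<open>The bound \<open>- a - 1\<close> on the derivative along \<open>v\<close>
      makes the sum \<open>-1\<close>, below the value 0 in direction 0.\<close>
    have "clarke_dir_deriv f x (v + - v) \<le> ereal ((- a - 1) + a)"
      by (rule clarke_dir_deriv_add_le) (use m a in auto)
    then show False by (simp add: clarke_dir_deriv_zero)
  qed
  with assms[of v] show ?thesis by (cases "clarke_dir_deriv f x v") auto
qed

text \<open>The directional derivative is a finite sublinear function. Subtracting the functional
  \<open>a\<close> gives one that is nonnegative on \<open>L\<close>; a minorant vanishing on
  \<open>L\<close>, shifted back by \<open>a\<close>, is the required subgradient.\<close>

lemma clarke_subgradient_extending:
  fixes f :: "'a::euclidean_space \<Rightarrow> real"
  assumes fin: "\<And>v. clarke_dir_deriv f x v < \<infinity>" and L: "subspace L"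
    and le: "\<And>u. u \<in> L \<Longrightarrow> ereal (a \<bullet> u) \<le> clarke_dir_deriv f x u"
  obtains w where "w \<in> clarke_subdiff f x" "\<And>u. u \<in> L \<Longrightarrow> w \<bullet> u = a \<bullet> u"
proof -
  define q where "q v = real_of_ereal (clarke_dir_deriv f x v)" for v
  have q: "clarke_dir_deriv f x v = ereal (q v)" for v
    unfolding q_def by (rule clarke_dir_deriv_finite[OF fin])
  have q_add: "q (v + w) \<le> q v + q w" for v w
    using clarke_dir_deriv_add_le[of f x v "q v" w "q w"] by (simp add: q)
  have q_scale: "q (s *\<^sub>R v) \<le> s * q v" if "s \<ge> 0" for s v
    using clarke_dir_deriv_scaleR_le[of f x v "q v" s] that by (simp add: q)
  obtain w where w: "\<And>v. w \<bullet> v \<le> q v - a \<bullet> v" "\<And>u. u \<in> L \<Longrightarrow> w \<bullet> u = 0"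
  proof (rule sublinear_minorant_vanishing_on_subspace[of "\<lambda>v. q v - a \<bullet> v" L])
    show "q (v + w) - a \<bullet> (v + w) \<le> q v - a \<bullet> v + (q w - a \<bullet> w)" for v w
      using q_add[of v w] by (simp add: inner_add_right)
    show "q (s *\<^sub>R v) - a \<bullet> (s *\<^sub>R v) \<le> s * (q v - a \<bullet> v)" if "s \<ge> 0" for s v
      using q_scale[OF that, of v] by (simp add: right_diff_distrib)
    show "0 \<le> q u - a \<bullet> u" if "u \<in> L" for u
      using le[OF that] by (simp add: q)
  qed (use L in auto)
  show ?thesis
  proof (rule that[of "w + a"])
    show "w + a \<in> clarke_subdiff f x"
      using w(1) by (auto simp: clarke_subdiff_def q inner_add_left algebra_simps)
  qed (simp add: w inner_add_left)
qed

text \<open>The directional derivative is the support function of the subdifferential. On the line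
  through \<open>v\<close> the functional sending \<open>v\<close> to \<open>q\<close> is
  represented by \<open>a\<close>, a multiple of \<open>v\<close>; it is dominated there and is then
  extended.\<close>

lemma clarke_dir_deriv_attained:
  fixes f :: "'a::euclidean_space \<Rightarrow> real"
  assumes fin: "\<And>v. clarke_dir_deriv f x v < \<infinity>"
  obtains w where "w \<in> clarke_subdiff f x" "ereal (w \<bullet> v) = clarke_dir_deriv f x v"
proof (cases "v = 0")
  case True
  obtain w where "w \<in> clarke_subdiff f x"
    using clarke_subgradient_extending[OF fin, of "{0}" 0]
    by (auto simp: clarke_dir_deriv_zero subspace_single_0)
  with True that show ?thesis by (simp add: clarke_dir_deriv_zero zero_ereal_def)
next
  case False
  define q where "q = real_of_ereal (clarke_dir_deriv f x v)"
  have q: "clarke_dir_deriv f x v = ereal q"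
    unfolding q_def by (rule clarke_dir_deriv_finite[OF fin])
  define a where "a = (q / (v \<bullet> v)) *\<^sub>R v"
  have av: "a \<bullet> v = q" using False by (simp add: a_def)
  have "ereal (a \<bullet> u) \<le> clarke_dir_deriv f x u" if "u \<in> span {v}" for u
  proof -
    obtain s where u: "u = s *\<^sub>R v" using \<open>u \<in> span {v}\<close> by (auto simp: span_singleton)
    define b where "b = real_of_ereal (clarke_dir_deriv f x u)"
    have b: "clarke_dir_deriv f x u = ereal b"
      unfolding b_def by (rule clarke_dir_deriv_finite[OF fin])
    have "s * q \<le> b"
    proof (cases "s > 0")
      case True
      have "clarke_dir_deriv f x ((1 / s) *\<^sub>R u) \<le> ereal (1 / s * b)"
        by (rule clarke_dir_deriv_scaleR_le) (use True b in auto)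
      with True show ?thesis by (simp add: u q field_simps)
    next
      case False
      \<comment> \<open>For \<open>s\<close> not positive, homogeneity applies only to
        \<open>- s\<close>; subadditivity on \<open>u + (- s) v = 0\<close> turns this into the
        lower bound for \<open>b\<close>.\<close>
      have "clarke_dir_deriv f x ((- s) *\<^sub>R v) \<le> ereal (- s * q)"
        by (rule clarke_dir_deriv_scaleR_le) (use False q in auto)
      then have "clarke_dir_deriv f x (u + (- s) *\<^sub>R v) \<le> ereal (b + - s * q)"
        by (intro clarke_dir_deriv_add_le) (simp_all add: b)
      then show ?thesis by (simp add: u clarke_dir_deriv_zero)
    qed
    then have "ereal (a \<bullet> u) \<le> ereal b" by (simp add: u av)
    then show ?thesis by (simp only: b)
  qed
  then obtain w where "w \<in> clarke_subdiff f x" "\<And>u. u \<in> span {v} \<Longrightarrow> w \<bullet> u = a \<bullet> u"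
    using clarke_subgradient_extending[OF fin subspace_span] by blast
  with that[of w] show ?thesis by (simp add: av q span_base)
qed

section \<open>Lipschitz bounds on directional derivatives and subgradients\<close>

lemma clarke_dir_deriv_le_lipschitz:
  fixes f :: "'a::real_normed_vector \<Rightarrow> real"
  assumes "L-lipschitz_on U f" "open U" "x \<in> U"
  shows "clarke_dir_deriv f x v \<le> ereal (L * norm v)"
  unfolding clarke_dir_deriv_le_iff
proof (intro allI impI)
  fix e assume e: "L * norm v < e"
  have "\<forall>\<^sub>F z in nhds x \<times>\<^sub>F at_right 0. fst z \<in> U"
    using tendsto_fst_prod_nhds assms(2,3) by (rule topological_tendstoD)
  moreover have "\<forall>\<^sub>F z in nhds x \<times>\<^sub>F at_right 0. fst z + snd z *\<^sub>R v \<in> U"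
    using tendsto_fst_plus_snd_scaleR assms(2,3) by (rule topological_tendstoD)
  ultimately show "\<forall>\<^sub>F z in nhds x \<times>\<^sub>F at_right 0.
      (f (fst z + snd z *\<^sub>R v) - f (fst z)) / snd z < e"
    using eventually_snd_pos[of "nhds x"]
  proof eventually_elim
    case (elim z)
    have "f (fst z + snd z *\<^sub>R v) - f (fst z) \<le> L * norm (snd z *\<^sub>R v)"
      using lipschitz_onD[OF assms(1) elim(2,1)] by (simp add: dist_norm)
    also have "\<dots> = (L * norm v) * snd z" using elim by simp
    also have "\<dots> < e * snd z" using e elim by simp
    finally show ?case using elim by (simp add: field_simps)
  qed
qed

lemma locally_lipschitz_clarke_finite:
  fixes f :: "'a::real_normed_vector \<Rightarrow> real"
  assumes "locally_lipschitz f"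
  shows "clarke_dir_deriv f x v < \<infinity>"
proof -
  obtain e L where "e > 0" "L-lipschitz_on (ball x e) f"
    using assms unfolding locally_lipschitz_def by blast
  then have "clarke_dir_deriv f x v \<le> ereal (L * norm v)"
    by (intro clarke_dir_deriv_le_lipschitz) auto
  then show ?thesis by (cases "clarke_dir_deriv f x v") auto
qed

lemma norm_clarke_subgradient_le:
  assumes "L-lipschitz_on U f" "open U" "x \<in> U" "w \<in> clarke_subdiff f x"
  shows "norm w \<le> L"
proof -
  have "ereal (w \<bullet> w) \<le> clarke_dir_deriv f x w"
    using assms(4) by (simp add: clarke_subdiff_def)
  also have "\<dots> \<le> ereal (L * norm w)"
    by (rule clarke_dir_deriv_le_lipschitz[OF assms(1-3)])
  finally have "norm w * norm w \<le> L * norm w"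
    by (simp add: power2_norm_eq_inner[symmetric] power2_eq_square)
  then show ?thesis
    using lipschitz_on_nonneg[OF assms(1)] by (cases "w = 0") auto
qed

text \<open>Finitely many balls with Lipschitz constants cover the compact set. The sum of these
  constants serves as the bound; unlike their maximum it also makes sense for an empty
  cover.\<close>

lemma bdd_above_clarke_subgradients:
  assumes "locally_lipschitz f" "compact K"
  shows "bdd_above {norm w | x w. x \<in> K \<and> w \<in> clarke_subdiff f x}"
proof -
  have "\<forall>x. \<exists>e L. e > 0 \<and> L-lipschitz_on (ball x e) f"
    using assms(1) unfolding locally_lipschitz_def by blast
  then obtain e L where e: "\<And>x. e x > 0" and L: "\<And>x. (L x)-lipschitz_on (ball x (e x)) f"
    by metis
  obtain C where C: "C \<subseteq> K" "finite C" "K \<subseteq> (\<Union>x\<in>C. ball x (e x))"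
    using compactE_image[OF assms(2), of K "\<lambda>x. ball x (e x)"] e by force
  have "norm w \<le> (\<Sum>c\<in>C. L c)" if xw: "x \<in> K" "w \<in> clarke_subdiff f x" for x w
  proof -
    obtain c where c: "c \<in> C" "x \<in> ball c (e c)" using C xw(1) by blast
    have "norm w \<le> L c"
      using norm_clarke_subgradient_le[OF L open_ball c(2) xw(2)] .
    also have "\<dots> \<le> (\<Sum>c\<in>C. L c)"
      using c C(2) lipschitz_on_nonneg[OF L] by (intro member_le_sum) auto
    finally show ?thesis .
  qed
  then show ?thesis by (auto simp: bdd_above_def)
qed

section \<open>Strict directional derivatives and a chain rule\<close>

text \<open>
  The base point varies together with the step, as in strict differentiability; a pointwise
  directional derivative would not control the Clarke derivative of a composition.
\<close>

definition has_strict_dir_deriv ::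
    "('a::real_normed_vector \<Rightarrow> 'b::real_normed_vector) \<Rightarrow> 'a \<Rightarrow> 'a \<Rightarrow> 'b \<Rightarrow> bool" where
  "has_strict_dir_deriv g x v d \<longleftrightarrow>
     ((\<lambda>z. (1 / snd z) *\<^sub>R (g (fst z + snd z *\<^sub>R v) - g (fst z))) \<longlongrightarrow> d) (nhds x \<times>\<^sub>F at_right 0)"

lemma has_strict_dir_deriv_const: "has_strict_dir_deriv (\<lambda>_. c) x v 0"
  by (simp add: has_strict_dir_deriv_def)

lemma has_strict_dir_deriv_ident: "has_strict_dir_deriv (\<lambda>y. y) x v v"
  unfolding has_strict_dir_deriv_def
  by (rule tendsto_eventually, use eventually_snd_pos[of "nhds x"] in eventually_elim) simp

lemma has_strict_dir_deriv_add:
  assumes "has_strict_dir_deriv g x v d" "has_strict_dir_deriv h x v e"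
  shows "has_strict_dir_deriv (\<lambda>y. g y + h y) x v (d + e)"
  using tendsto_add[OF assms[unfolded has_strict_dir_deriv_def]]
  by (simp add: has_strict_dir_deriv_def algebra_simps)

lemma has_strict_dir_deriv_linear:
  assumes "bounded_linear T" "has_strict_dir_deriv g x v d"
  shows "has_strict_dir_deriv (\<lambda>y. T (g y)) x v (T d)"
proof -
  interpret T: bounded_linear T by fact
  show ?thesis
    using T.tendsto[OF assms(2)[unfolded has_strict_dir_deriv_def]]
    by (simp add: has_strict_dir_deriv_def T.diff T.scaleR)
qed

lemma has_strict_dir_deriv_bilinear:
  assumes "bounded_bilinear B" "has_strict_dir_deriv g x v d" "has_strict_dir_deriv h x v e"
    "isCont g x" "isCont h x"
  shows "has_strict_dir_deriv (\<lambda>y. B (g y) (h y)) x v (B d (h x) + B (g x) e)"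
proof -
  interpret B: bounded_bilinear B by fact
  \<comment> \<open>The difference quotient of the product, split by changing \<open>g\<close> first
    with \<open>h\<close> at the new point and then \<open>h\<close> with \<open>g\<close> at the
    old point.\<close>
  have "((\<lambda>z. B ((1 / snd z) *\<^sub>R (g (fst z + snd z *\<^sub>R v) - g (fst z))) (h (fst z + snd z *\<^sub>R v))
      + B (g (fst z)) ((1 / snd z) *\<^sub>R (h (fst z + snd z *\<^sub>R v) - h (fst z))))
      \<longlongrightarrow> B d (h x) + B (g x) e) (nhds x \<times>\<^sub>F at_right 0)"
    using assms(2-) unfolding has_strict_dir_deriv_def
    by (intro tendsto_add B.tendsto isCont_tendsto_compose[OF assms(4)] isCont_tendsto_compose[OF assms(5)]
        tendsto_fst_plus_snd_scaleR tendsto_fst_prod_nhds)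
  then show ?thesis
    by (simp add: has_strict_dir_deriv_def B.diff_left B.diff_right B.scaleR_left B.scaleR_right
        scaleR_diff_right)
qed

text \<open>Strict differentiability replaces \<open>A (y + t v)\<close> by \<open>A y + t u\<close>
  up to an error of order o(t), which costs only o(t) in \<open>f\<close> by the Lipschitz
  condition. What remains is a Clarke quotient of \<open>f\<close> at the base point
  \<open>A y\<close>, which tends to \<open>A x\<close>.\<close>

lemma clarke_dir_deriv_compose_add_le:
  fixes f :: "'b::real_normed_vector \<Rightarrow> real"
  assumes lip: "locally_lipschitz f" and cont: "isCont A x"
    and A: "has_strict_dir_deriv A x v u" and g: "has_strict_dir_deriv g x v d"
    and c: "clarke_dir_deriv f (A x) u \<le> ereal c"
  shows "clarke_dir_deriv (\<lambda>y. f (A y) + g y) x v \<le> ereal (c + d)"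
  unfolding clarke_dir_deriv_le_iff
proof (intro allI impI)
  let ?F = "nhds x \<times>\<^sub>F at_right (0::real)"
  fix e assume e: "c + d < e"
  \<comment> \<open>The slack is shared in thirds by the quotient of \<open>f\<close>, the quotient
    of \<open>g\<close> and the Lipschitz error.\<close>
  define h where "h = (e - (c + d)) / 3"
  have h: "h > 0" using e by (simp add: h_def)
  obtain r L where r: "r > 0" and L: "L-lipschitz_on (ball (A x) r) f"
    using lip unfolding locally_lipschitz_def by blast
  have L0: "L \<ge> 0" using L by (rule lipschitz_on_nonneg)
  have A1: "((\<lambda>z. A (fst z)) \<longlongrightarrow> A x) ?F"
    by (rule isCont_tendsto_compose[OF cont tendsto_fst_prod_nhds])
  have A2: "((\<lambda>z. A (fst z + snd z *\<^sub>R v)) \<longlongrightarrow> A x) ?F"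
    by (rule isCont_tendsto_compose[OF cont tendsto_fst_plus_snd_scaleR])
  have A3: "((\<lambda>z. A (fst z) + snd z *\<^sub>R u) \<longlongrightarrow> A x) ?F"
    using tendsto_add[OF A1 tendsto_scaleR[OF tendsto_snd_prod_at_right tendsto_const]] by simp
  have "filterlim (\<lambda>z. (A (fst z), snd z)) (nhds (A x) \<times>\<^sub>F at_right 0) ?F"
    by (intro filterlim_Pair A1 filterlim_snd_prod)
  moreover have "\<forall>\<^sub>F z in nhds (A x) \<times>\<^sub>F at_right 0.
      (f (fst z + snd z *\<^sub>R u) - f (fst z)) / snd z < c + h"
    using c h unfolding clarke_dir_deriv_le_iff by simp
  ultimately have "\<forall>\<^sub>F z in ?F. (f (A (fst z) + snd z *\<^sub>R u) - f (A (fst z))) / snd z < c + h"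
    by (auto dest: eventually_compose_filterlim)
  \<comment> \<open>The denominator \<open>L + 1\<close> stays positive when
    \<open>L = 0\<close>.\<close>
  moreover have "\<forall>\<^sub>F z in ?F. dist ((1 / snd z) *\<^sub>R (A (fst z + snd z *\<^sub>R v) - A (fst z))) u < h / (L + 1)"
    using A unfolding has_strict_dir_deriv_def by (rule tendstoD) (use h L0 in auto)
  moreover have "\<forall>\<^sub>F z in ?F. (1 / snd z) *\<^sub>R (g (fst z + snd z *\<^sub>R v) - g (fst z)) < d + h"
    using g unfolding has_strict_dir_deriv_def by (rule order_tendstoD) (use h in auto)
  moreover have "\<forall>\<^sub>F z in ?F. A (fst z + snd z *\<^sub>R v) \<in> ball (A x) r"
    using A2 r by (intro topological_tendstoD) auto
  moreover have "\<forall>\<^sub>F z in ?F. A (fst z) + snd z *\<^sub>R u \<in> ball (A x) r"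
    using A3 r by (intro topological_tendstoD) auto
  ultimately show "\<forall>\<^sub>F z in ?F.
      (f (A (fst z + snd z *\<^sub>R v)) + g (fst z + snd z *\<^sub>R v) - (f (A (fst z)) + g (fst z))) / snd z < e"
    using eventually_snd_pos[of "nhds x"]
  proof eventually_elim
    case (elim z)
    define t where "t = snd z"
    have t: "t > 0" using elim by (simp add: t_def)
    define D where "D = (1 / t) *\<^sub>R (A (fst z + t *\<^sub>R v) - A (fst z)) - u"
    have D: "A (fst z + t *\<^sub>R v) - (A (fst z) + t *\<^sub>R u) = t *\<^sub>R D"
      using t by (simp add: D_def algebra_simps)
    have "norm D < h / (L + 1)" using elim(2) by (simp add: D_def t_def dist_norm)
    then have "L * norm D \<le> L * (h / (L + 1))" using L0 by (intro mult_left_mono) auto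
    also have "\<dots> \<le> h" using L0 h by (simp add: field_simps)
    finally have LD: "L * norm D \<le> h" .
    have "f (A (fst z + t *\<^sub>R v)) - f (A (fst z) + t *\<^sub>R u) \<le> L * norm (t *\<^sub>R D)"
      using lipschitz_onD[OF L elim(4,5)] by (simp add: dist_norm t_def[symmetric] D)
    also have "\<dots> = (L * norm D) * t" using t by simp
    also have "\<dots> \<le> h * t" using LD t by (intro mult_right_mono) auto
    finally have "(f (A (fst z + t *\<^sub>R v)) - f (A (fst z) + t *\<^sub>R u)) / t \<le> h"
      using t by (simp add: field_simps)
    moreover have "(f (A (fst z) + t *\<^sub>R u) - f (A (fst z))) / t < c + h"
      using elim(1) by (simp add: t_def)
    moreover have "(g (fst z + t *\<^sub>R v) - g (fst z)) / t < d + h"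
      using elim(3) by (simp add: t_def)
    moreover have "c + d + 3 * h = e" by (simp add: h_def field_simps)
    ultimately show ?case
      unfolding t_def[symmetric] by (simp add: diff_divide_distrib add_divide_distrib)
  qed
qed

section \<open>Matrix calculus for the constraint dissolving map\<close>

lemma norm_matrix_mult_le:
  fixes A :: "real^'n^'m" and B :: "real^'p^'n"
  shows "norm (A ** B) \<le> norm A * norm B"
proof (rule power2_le_imp_le)
  have sq: "(norm C)\<^sup>2 = (\<Sum>i\<in>UNIV. \<Sum>j\<in>UNIV. (C $ i $ j)\<^sup>2)" for C :: "real^'a^'b"
    by (simp add: norm_eq_frobenius sum_nonneg)
  have "(norm (A ** B))\<^sup>2 = (\<Sum>i\<in>UNIV. \<Sum>j\<in>UNIV. (\<Sum>k\<in>UNIV. A $ i $ k * B $ k $ j)\<^sup>2)"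
    by (simp add: sq matrix_matrix_mult_def)
  also have "\<dots> \<le> (\<Sum>i\<in>UNIV. \<Sum>j\<in>UNIV. (\<Sum>k\<in>UNIV. (A $ i $ k)\<^sup>2) * (\<Sum>k\<in>UNIV. (B $ k $ j)\<^sup>2))"
    by (intro sum_mono Cauchy_Schwarz_ineq_sum)
  also have "\<dots> = (norm A)\<^sup>2 * (\<Sum>j\<in>UNIV. \<Sum>k\<in>UNIV. (B $ k $ j)\<^sup>2)"
    by (simp add: sq sum_product)
  also have "\<dots> = (norm A * norm B)\<^sup>2"
    by (subst sum.swap) (simp add: sq power_mult_distrib)
  finally show "(norm (A ** B))\<^sup>2 \<le> (norm A * norm B)\<^sup>2" .
qed simp

interpretation matmul: bounded_bilinear "(**) :: real^'n^'m \<Rightarrow> real^'p^'n \<Rightarrow> real^'p^'m"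
proof
  show "\<exists>K. \<forall>(A::real^'n^'m) (B::real^'p^'n). norm (A ** B) \<le> norm A * norm B * K"
    using norm_matrix_mult_le by (intro exI[of _ 1]) auto
qed (simp_all add: matrix_matrix_mult_def vec_eq_iff algebra_simps sum.distrib sum_distrib_left)

lemma bounded_linear_transpose: "bounded_linear (transpose :: real^'n^'m \<Rightarrow> real^'m^'n)"
  unfolding linear_conv_bounded_linear[symmetric]
  by (rule linearI) (simp_all add: transpose_def vec_eq_iff)

lemmas transpose_linear = bounded_linear_transpose[THEN bounded_linear.linear, THEN linear_add]
  bounded_linear_transpose[THEN bounded_linear.linear, THEN linear_diff]
  bounded_linear_transpose[THEN bounded_linear.linear, THEN linear_neg] transpose_scalar

lemmas matrix_expand = matmul.add_left matmul.add_right matmul.diff_left matmul.diff_right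
  matmul.minus_left matmul.minus_right matmul.scaleR_left matmul.scaleR_right
  transpose_linear matrix_transpose_mul

lemma inner_matrix_mult_left:
  fixes A :: "real^'n^'m" and B :: "real^'p^'n"
  shows "(A ** B) \<bullet> C = B \<bullet> (transpose A ** C)"
  by (simp add: inner_eq_trace matrix_transpose_mul matrix_mul_assoc)

lemma inner_transpose:
  fixes A B :: "real^'n^'m"
  shows "transpose A \<bullet> transpose B = A \<bullet> B"
  by (simp add: inner_vec_def transpose_def) (rule sum.swap)

section \<open>The dissolving map expanded in the Gram defect, and its derivative\<close>

definition gram_defect :: "real^'p^'n \<Rightarrow> real^'p^'p" where
  "gram_defect X = transpose X ** X - mat 1"

lemma gram_eq: "transpose X ** X = mat 1 + gram_defect X"
  by (simp add: gram_defect_def)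

lemma transpose_gram_defect: "transpose (gram_defect X) = gram_defect X"
  by (simp add: gram_defect_def transpose_linear matrix_transpose_mul)

text \<open>With \<open>X^T X = I + E\<close> the polynomial becomes
  \<open>I - E/2 + 3 E^2/8\<close>, the second-order Taylor polynomial of
  \<open>(I + E)^(-1/2)\<close>. The map thus approximates the polar factor of \<open>X\<close>,
  which explains the cancellations below.\<close>

lemma dissolve_eq:
  "dissolve X = X - (1/2) *\<^sub>R (X ** gram_defect X)
     + (3/8) *\<^sub>R (X ** gram_defect X ** gram_defect X)"
  unfolding dissolve_def gram_eq
  by (simp only: matrix_expand matrix_mul_assoc matrix_mul_lid matrix_mul_rid) (simp add: vec_eq_iff field_simps)

lemma isCont_gram_defect: "isCont gram_defect X"
  unfolding gram_defect_def by (intro continuous_intros matmul.isCont bounded_linear.isCont[OF bounded_linear_transpose])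

lemma isCont_dissolve: "isCont dissolve X"
  unfolding dissolve_eq by (intro continuous_intros matmul.isCont isCont_gram_defect)

lemma strict_dir_deriv_gram_defect:
  "has_strict_dir_deriv gram_defect X V (transpose V ** X + transpose X ** V)"
proof -
  have "has_strict_dir_deriv (\<lambda>Y. transpose Y ** Y + (- mat 1)) X V
      (transpose V ** X + transpose X ** V + 0)"
    by (intro has_strict_dir_deriv_add has_strict_dir_deriv_const
        has_strict_dir_deriv_bilinear[OF matmul.bounded_bilinear_axioms]
        has_strict_dir_deriv_linear[OF bounded_linear_transpose]
        has_strict_dir_deriv_ident bounded_linear.isCont[OF bounded_linear_transpose] continuous_ident)
  then show ?thesis by (simp add: gram_defect_def[abs_def])
qed

text \<open>The product rule for the expansion in \<open>E\<close>. The derivative \<open>F\<close>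
  of the Gram defect need not commute with \<open>E\<close>, so \<open>X ** F ** E\<close> and
  \<open>X ** E ** F\<close> are separate terms.\<close>

definition dissolve_deriv :: "real^'p^'n \<Rightarrow> real^'p^'n \<Rightarrow> real^'p^'n" where
  "dissolve_deriv X V =
    (let E = gram_defect X; F = transpose V ** X + transpose X ** V
     in V - (1/2) *\<^sub>R (V ** E + X ** F)
        + (3/8) *\<^sub>R (V ** E ** E + X ** F ** E + X ** E ** F))"

lemma strict_dir_deriv_dissolve:
  "has_strict_dir_deriv dissolve X V (dissolve_deriv X V)"
proof -
  let ?E = "gram_defect X" and ?F = "transpose V ** X + transpose X ** V"
  have 1: "has_strict_dir_deriv (\<lambda>Y. Y ** gram_defect Y) X V (V ** ?E + X ** ?F)"
    by (intro has_strict_dir_deriv_bilinear[OF matmul.bounded_bilinear_axioms]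
        has_strict_dir_deriv_ident strict_dir_deriv_gram_defect isCont_gram_defect continuous_ident)
  have 2: "has_strict_dir_deriv (\<lambda>Y. Y ** gram_defect Y ** gram_defect Y) X V
      ((V ** ?E + X ** ?F) ** ?E + X ** ?E ** ?F)"
    by (intro has_strict_dir_deriv_bilinear[OF matmul.bounded_bilinear_axioms 1]
        strict_dir_deriv_gram_defect isCont_gram_defect matmul.isCont continuous_ident)
  have "has_strict_dir_deriv (\<lambda>Y. Y + (-1/2) *\<^sub>R (Y ** gram_defect Y)
        + (3/8) *\<^sub>R (Y ** gram_defect Y ** gram_defect Y)) X V
      (V + (-1/2) *\<^sub>R (V ** ?E + X ** ?F) + (3/8) *\<^sub>R ((V ** ?E + X ** ?F) ** ?E + X ** ?E ** ?F))"
    by (intro has_strict_dir_deriv_add has_strict_dir_deriv_ident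
        has_strict_dir_deriv_linear[OF bounded_linear_scaleR_right] 1 2)
  then show ?thesis
    by (simp add: dissolve_eq[abs_def] dissolve_deriv_def Let_def matmul.add_left)
qed

lemma strict_dir_deriv_penalty_term:
  "has_strict_dir_deriv (\<lambda>Y. \<beta> / 4 * (norm (gram_defect Y))\<^sup>2) X V
     (\<beta> / 2 * (gram_defect X \<bullet> (transpose V ** X + transpose X ** V)))"
proof -
  have "has_strict_dir_deriv (\<lambda>Y. \<beta> / 4 * (gram_defect Y \<bullet> gram_defect Y)) X V
     (\<beta> / 4 * ((transpose V ** X + transpose X ** V) \<bullet> gram_defect X
        + gram_defect X \<bullet> (transpose V ** X + transpose X ** V)))"
    by (intro has_strict_dir_deriv_linear[OF bounded_linear_mult_right]
        has_strict_dir_deriv_bilinear[OF bounded_bilinear_inner]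
        strict_dir_deriv_gram_defect isCont_gram_defect)
  then show ?thesis
    by (simp add: power2_norm_eq_inner inner_commute[of _ "gram_defect X"])
qed

lemma clarke_dir_deriv_penalty_le:
  assumes "locally_lipschitz f"
    and "clarke_dir_deriv f (dissolve X) (dissolve_deriv X V) \<le> ereal c"
  shows "clarke_dir_deriv (penalty f \<beta>) X V
    \<le> ereal (c + \<beta> / 2 * (gram_defect X \<bullet> (transpose V ** X + transpose X ** V)))"
  using clarke_dir_deriv_compose_add_le[OF assms(1) isCont_dissolve strict_dir_deriv_dissolve
      strict_dir_deriv_penalty_term assms(2)]
  by (simp add: penalty_def[abs_def] gram_defect_def)

text \<open>In this direction \<open>F = - 2 (E + E^2)\<close> commutes with \<open>E\<close>. The
  terms in \<open>X E\<close> cancel between \<open>V\<close> and the factor 1/2 part, and those in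
  \<open>X E^2\<close> between the factor 1/2 and 3/8 parts.\<close>

lemma dissolve_deriv_normal:
  "dissolve_deriv X (- (X ** gram_defect X)) =
     (- 15/8) *\<^sub>R (X ** gram_defect X ** gram_defect X ** gram_defect X)"
proof -
  let ?E = "gram_defect X"
  have "transpose (- (X ** ?E)) ** X + transpose X ** (- (X ** ?E)) = - 2 *\<^sub>R (?E + ?E ** ?E)"
    by (simp add: matrix_expand transpose_gram_defect matrix_mul_assoc[of "transpose X"]
        matrix_mul_assoc[of ?E "transpose X", symmetric] gram_eq)
      (simp add: vec_eq_iff)
  then show ?thesis
    unfolding dissolve_deriv_def Let_def
    by (simp add: matrix_expand matrix_mul_assoc) (simp add: vec_eq_iff field_simps)
qed

text \<open>The two summands are transposes of each other and \<open>E\<close> is symmetric, so each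
  contributes the inner product of \<open>X E\<close> with \<open>V\<close>.\<close>

lemma inner_gram_defect_normal:
  fixes X :: "real^'p^'n"
  defines "V \<equiv> - (X ** gram_defect X)"
  shows "gram_defect X \<bullet> (transpose V ** X + transpose X ** V) = - 2 * (norm (X ** gram_defect X))\<^sup>2"
proof -
  let ?E = "gram_defect X"
  have 1: "(X ** ?E) \<bullet> (X ** ?E) = ?E \<bullet> (transpose X ** X ** ?E)"
    by (simp add: inner_matrix_mult_left matrix_mul_assoc)
  have "?E \<bullet> (transpose (X ** ?E) ** X) = transpose ?E \<bullet> transpose (transpose (X ** ?E) ** X)"
    by (simp only: inner_transpose)
  also have "\<dots> = ?E \<bullet> (transpose X ** X ** ?E)"
    by (simp add: matrix_transpose_mul transpose_gram_defect matrix_mul_assoc)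
  finally show ?thesis
    by (simp add: V_def matrix_expand inner_add_right inner_diff_right power2_norm_eq_inner 1 matrix_mul_assoc)
qed

text \<open>Moving \<open>X\<close> across the inner product gives \<open><E, (I + E) E>\<close>,
  and the cubic remainder \<open><E, E^2>\<close> is at most the cube of the norm of
  \<open>E\<close> in absolute value.\<close>

lemma norm_mult_gram_defect_ge:
  "(norm (X ** gram_defect X))\<^sup>2 \<ge> (norm (gram_defect X))\<^sup>2 * (1 - norm (gram_defect X))"
proof -
  let ?E = "gram_defect X"
  have "(norm (X ** ?E))\<^sup>2 = ?E \<bullet> (transpose X ** X ** ?E)"
    by (simp add: power2_norm_eq_inner inner_matrix_mult_left matrix_mul_assoc)
  also have "\<dots> = (norm ?E)\<^sup>2 + ?E \<bullet> (?E ** ?E)"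
    by (simp add: gram_eq matrix_expand inner_add_right power2_norm_eq_inner)
  finally have eq: "(norm (X ** ?E))\<^sup>2 = (norm ?E)\<^sup>2 + ?E \<bullet> (?E ** ?E)" .
  have "\<bar>?E \<bullet> (?E ** ?E)\<bar> \<le> norm ?E * norm (?E ** ?E)" by (rule Cauchy_Schwarz_ineq2)
  also have "\<dots> \<le> norm ?E * (norm ?E * norm ?E)"
    by (intro mult_left_mono norm_matrix_mult_le) auto
  finally have "- (norm ?E * (norm ?E * norm ?E)) \<le> ?E \<bullet> (?E ** ?E)" by linarith
  moreover have "(norm ?E)\<^sup>2 * (1 - norm ?E) = (norm ?E)\<^sup>2 - norm ?E * (norm ?E * norm ?E)"
    by (simp add: power2_eq_square algebra_simps)
  ultimately show ?thesis unfolding eq by linarith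
qed

text \<open>The map is \<open>X Q\<close> with \<open>Q\<close> a symmetric polynomial in
  \<open>E\<close>, so the new Gram matrix is \<open>Q (I + E) Q\<close>. Because \<open>Q\<close>
  agrees with \<open>(I + E)^(-1/2)\<close> to second order, the defect starts at
  \<open>E^3\<close>.\<close>

lemma gram_defect_dissolve:
  fixes X :: "real^'p^'n"
  defines "E \<equiv> gram_defect X"
  shows "gram_defect (dissolve X) = (40/64) *\<^sub>R (E ** E ** E) - (15/64) *\<^sub>R (E ** E ** E ** E)
     + (9/64) *\<^sub>R (E ** E ** E ** E ** E)"
proof -
  define Q where "Q = mat 1 - (1/2) *\<^sub>R E + (3/8) *\<^sub>R (E ** E)"
  have d: "dissolve X = X ** Q"
    by (simp add: dissolve_eq Q_def E_def matrix_expand matrix_mul_assoc)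
  have Q: "transpose Q = Q"
    by (simp add: Q_def matrix_expand) (simp add: E_def transpose_gram_defect)
  have "transpose (dissolve X) ** dissolve X = Q ** (transpose X ** X) ** Q"
    by (simp add: d matrix_transpose_mul Q matrix_mul_assoc)
  also have "\<dots> = Q ** (mat 1 + E) ** Q"
    by (simp add: gram_eq E_def)
  also have "\<dots> = mat 1 + (40/64) *\<^sub>R (E ** E ** E) - (15/64) *\<^sub>R (E ** E ** E ** E)
     + (9/64) *\<^sub>R (E ** E ** E ** E ** E)"
    unfolding Q_def by (simp add: matrix_expand matrix_mul_assoc) (simp add: vec_eq_iff field_simps)
  finally show ?thesis by (simp add: gram_defect_def)
qed

text \<open>The coefficients of the new defect have absolute values summing to
  \<open>(40 + 15 + 9)/64 = 1\<close>. This puts the image where the constant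
  \<open>subgrad_bound f\<close> controls the subgradients of \<open>f\<close>.\<close>

lemma dissolve_in_Omega_1:
  fixes X :: "real^'p^'n"
  assumes "norm (gram_defect X) \<le> 1"
  shows "dissolve X \<in> Omega 1"
proof -
  define E where "E = gram_defect X"
  have E1: "norm E \<le> 1" using assms by (simp add: E_def)
  have step: "norm (A ** E) \<le> 1" if "norm A \<le> 1" for A :: "real^'p^'p"
    using norm_matrix_mult_le[of A E] mult_mono[OF that E1] by simp
  have "norm (gram_defect (dissolve X))
      \<le> 40/64 * norm (E ** E ** E) + 15/64 * norm (E ** E ** E ** E)
        + 9/64 * norm (E ** E ** E ** E ** E)"
    unfolding gram_defect_dissolve E_def[symmetric]
    by (rule order_trans[OF norm_triangle_ineq], rule add_mono,
        rule order_trans[OF norm_triangle_ineq4]) simp_all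
  also have "\<dots> \<le> 40/64 * 1 + 15/64 * 1 + 9/64 * 1"
    by (intro add_mono mult_left_mono step E1) auto
  finally show ?thesis by (simp add: Omega_def gram_defect_def)
qed

section \<open>Finiteness of the subgradient bound\<close>

lemma compact_Omega: "compact (Omega r :: (real^'p^'n) set)"
  unfolding compact_eq_bounded_closed
proof
  have "norm X \<le> 1 + norm (mat 1 :: real^'p^'p) * (r + norm (mat 1 :: real^'p^'p))"
    if "X \<in> Omega r" for X :: "real^'p^'n"
  proof -
    \<comment> \<open>A linear bound by the square suffices, since the squared norm is the trace of
      the Gram matrix.\<close>
    have "norm X \<le> 1 + (norm X)\<^sup>2"
      using zero_le_power2[of "norm X - 1/2"] by (simp add: power2_eq_square algebra_simps)
    also have "(norm X)\<^sup>2 = mat 1 \<bullet> (transpose X ** X)"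
      using inner_matrix_mult_left[of X "mat 1" X] by (simp add: power2_norm_eq_inner)
    also have "\<dots> \<le> norm (mat 1 :: real^'p^'p) * norm (transpose X ** X)"
      by (rule norm_cauchy_schwarz)
    also have "\<dots> \<le> norm (mat 1 :: real^'p^'p) * (r + norm (mat 1 :: real^'p^'p))"
      using that norm_triangle_sub[of "transpose X ** X" "mat 1"]
      by (intro mult_left_mono) (auto simp: Omega_def)
    finally show ?thesis by simp
  qed
  then show "bounded (Omega r :: (real^'p^'n) set)" by (auto simp: bounded_iff)
  have "continuous_on UNIV (\<lambda>X :: real^'p^'n. norm (gram_defect X))"
    by (intro continuous_at_imp_continuous_on ballI continuous_norm isCont_gram_defect)
  then have "closed {X :: real^'p^'n. norm (gram_defect X) \<le> r}"
    by (intro closed_Collect_le) auto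
  then show "closed (Omega r :: (real^'p^'n) set)" by (simp add: Omega_def gram_defect_def)
qed

lemma subgrad_bound_nonneg:
  assumes "locally_lipschitz f"
  shows "subgrad_bound f \<ge> 0"
  unfolding subgrad_bound_def
  by (rule cSup_upper) (use bdd_above_clarke_subgradients[OF assms compact_Omega] in auto)

lemma norm_le_subgrad_bound:
  assumes "locally_lipschitz f" "X \<in> Omega 1" "W \<in> clarke_subdiff f X"
  shows "norm W \<le> subgrad_bound f"
  unfolding subgrad_bound_def
  by (rule cSup_upper) (use bdd_above_clarke_subgradients[OF assms(1) compact_Omega] assms in auto)

text \<open>A subgradient attaining the directional derivative turns the bound on norms of
  subgradients into a bound on directions.\<close>

lemma clarke_dir_deriv_le_subgrad_bound:
  assumes "locally_lipschitz f" "X \<in> Omega 1"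
  shows "clarke_dir_deriv f X V \<le> ereal (subgrad_bound f * norm V)"
proof -
  obtain W where W: "W \<in> clarke_subdiff f X" "ereal (W \<bullet> V) = clarke_dir_deriv f X V"
    using clarke_dir_deriv_attained[OF locally_lipschitz_clarke_finite[OF assms(1)]] by blast
  have "W \<bullet> V \<le> norm W * norm V" by (rule norm_cauchy_schwarz)
  also have "\<dots> \<le> subgrad_bound f * norm V"
    by (intro mult_right_mono norm_le_subgrad_bound[OF assms W(1)]) auto
  finally show ?thesis by (simp flip: W(2))
qed

text \<open>The distance bound needs this because \<^const>\<open>infdist\<close> to the empty set is 0.\<close>

lemma clarke_subdiff_penalty_nonempty:
  assumes "locally_lipschitz f"
  shows "clarke_subdiff (penalty f \<beta>) X \<noteq> {}"
proof -
  have "clarke_dir_deriv (penalty f \<beta>) X V < \<infinity>" for V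
  proof -
    obtain c where "clarke_dir_deriv f (dissolve X) (dissolve_deriv X V) \<le> ereal c"
      using locally_lipschitz_clarke_finite[OF assms, of "dissolve X" "dissolve_deriv X V"]
      by (cases "clarke_dir_deriv f (dissolve X) (dissolve_deriv X V)") auto
    from clarke_dir_deriv_penalty_le[OF assms this, of \<beta>] show ?thesis
      by (cases "clarke_dir_deriv (penalty f \<beta>) X V") auto
  qed
  from clarke_dir_deriv_attained[OF this] show ?thesis by blast
qed

section \<open>Stationarity of the penalty function\<close>

lemma norm_penalty_subgradient_ge:
  assumes lip: "locally_lipschitz f" and \<beta>: "\<beta> > 0"
    and r: "r < \<beta> / (2 * \<beta> + 8 * subgrad_bound f)" and X: "X \<in> Omega r"
    and D: "D \<in> clarke_subdiff (penalty f \<beta>) X"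
  shows "\<beta> / 4 * norm (gram_defect X) \<le> norm D"
proof (cases "gram_defect X = 0")
  case False
  define E where "E = gram_defect X"
  define c where "c = norm E"
  define N where "N = norm (X ** E)"
  define M where "M = subgrad_bound f"
  have M: "M \<ge> 0" unfolding M_def by (rule subgrad_bound_nonneg[OF lip])
  have c: "c > 0" using False by (simp add: c_def E_def)
  have cr: "c \<le> r" using X by (simp add: c_def E_def Omega_def gram_defect_def)
  have pos: "2 * \<beta> + 8 * M > 0" using \<beta> M by simp
  have "c < \<beta> / (2 * \<beta> + 8 * M)" using cr r by (simp add: M_def)
  then have "c * (2 * \<beta> + 8 * M) < \<beta>" by (simp only: pos_less_divide_eq[OF pos])
  \<comment> \<open>The single inequality from the range of \<open>r\<close> gives both
    \<open>c < 1/2\<close> and the bound \<open>\<beta> / 8\<close> on \<open>c * M\<close>.\<close>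
  then have b1: "2 * (c * \<beta>) + 8 * (c * M) < \<beta>" by (simp add: algebra_simps)
  have "c * M \<ge> 0" using c M by simp
  with b1 have "2 * (c * \<beta>) < \<beta>" by linarith
  then have c12: "c < 1/2" using \<beta> by (simp add: field_simps)
  have cM: "c * M \<le> \<beta> / 8" using b1 c \<beta> mult_pos_pos[OF c \<beta>] by linarith
  have "N\<^sup>2 \<ge> c\<^sup>2 * (1 - c)"
    unfolding N_def c_def E_def by (rule norm_mult_gram_defect_ge)
  moreover have "c\<^sup>2 * (1 - c) \<ge> c\<^sup>2 * (1/2)"
    using c12 by (intro mult_left_mono) auto
  moreover have "c\<^sup>2 > 0" using c by simp
  \<comment> \<open>\<open>7/10\<close> is a rational lower bound for \<open>sqrt (1/2)\<close>.\<close>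
  ultimately have "N\<^sup>2 \<ge> (7/10 * c)\<^sup>2" by (simp add: power_mult_distrib power2_eq_square)
  then have Nc: "N \<ge> 7/10 * c" by (rule power2_le_imp_le) (simp add: N_def)
  then have N: "N > 0" using c by linarith
  define V where "V = - (X ** E)"
  have Om: "dissolve X \<in> Omega 1"
    by (rule dissolve_in_Omega_1) (use c12 in \<open>simp add: c_def E_def\<close>)
  have "norm (X ** E ** E ** E) \<le> norm (X ** E) * c * c"
    unfolding c_def
    by (rule order_trans[OF norm_matrix_mult_le mult_right_mono[OF norm_matrix_mult_le]]) simp
  then have "norm (dissolve_deriv X V) \<le> 15/8 * (N * c * c)"
    unfolding V_def E_def dissolve_deriv_normal by (simp add: N_def E_def)
  then have "subgrad_bound f * norm (dissolve_deriv X V) \<le> M * (15/8 * (N * c * c))"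
    unfolding M_def[symmetric] using M by (rule mult_left_mono)
  then have "clarke_dir_deriv f (dissolve X) (dissolve_deriv X V) \<le> ereal (M * (15/8 * (N * c * c)))"
    using clarke_dir_deriv_le_subgrad_bound[OF lip Om, of "dissolve_deriv X V"]
    by (meson ereal_less_eq(3) order_trans)
  from clarke_dir_deriv_penalty_le[OF lip this, of \<beta>]
  have "clarke_dir_deriv (penalty f \<beta>) X V \<le> ereal (M * (15/8 * (N * c * c)) - \<beta> * N\<^sup>2)"
    unfolding V_def E_def inner_gram_defect_normal by (simp add: N_def E_def)
  then have "ereal (D \<bullet> V) \<le> ereal (M * (15/8 * (N * c * c)) - \<beta> * N\<^sup>2)"
    using D order_trans unfolding clarke_subdiff_def by blast
  then have "D \<bullet> V \<le> M * (15/8 * (N * c * c)) - \<beta> * N\<^sup>2" by simp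
  moreover have "- (D \<bullet> V) \<le> norm D * N"
    using norm_cauchy_schwarz[of D "X ** E"] by (simp add: V_def N_def)
  ultimately have "(\<beta> * N - 15/8 * (c * M) * c) * N \<le> norm D * N"
    by (simp add: algebra_simps power2_eq_square)
  \<comment> \<open>After division by \<open>N\<close> the penalty contributes at least
    \<open>7/10 * \<beta> * c\<close> and the \<open>f\<close> part costs at most
    \<open>15/64 * \<beta> * c\<close>; the difference exceeds
    \<open>\<beta> * c / 4\<close>.\<close>
  then have "\<beta> * N - 15/8 * (c * M) * c \<le> norm D" using N by simp
  moreover have "c * M * c \<le> \<beta> / 8 * c" using cM c by (intro mult_right_mono) auto
  moreover have "\<beta> * (7/10 * c) \<le> \<beta> * N" using Nc \<beta> by (intro mult_left_mono) auto
  moreover have "\<beta> * c > 0" using \<beta> c by simp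
  ultimately show ?thesis unfolding E_def[symmetric] c_def[symmetric] by simp
qed simp

lemma dissolve_deriv_stiefel:
  assumes "gram_defect X = 0"
  shows "dissolve_deriv X V = V - X ** sym_part (transpose X ** V)"
proof -
  have "transpose V ** X + transpose X ** V = 2 *\<^sub>R sym_part (transpose X ** V)"
    by (simp add: sym_part_def matrix_transpose_mul)
  then show ?thesis by (simp add: dissolve_deriv_def assms matmul.scaleR_right)
qed

text \<open>Self-adjointness of the projection: symmetrization is self-adjoint, and multiplication
  by \<open>X\<close> has the adjoint multiplication by its transpose.\<close>

lemma inner_tangent_projection:
  fixes X V W :: "real^'p^'n"
  shows "(W - X ** sym_part (transpose X ** W)) \<bullet> V = W \<bullet> (V - X ** sym_part (transpose X ** V))"
proof -
  have s: "sym_part A \<bullet> B = A \<bullet> sym_part B" for A B :: "real^'p^'p"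
    using inner_transpose[of A "transpose B"]
    by (simp add: sym_part_def inner_add_left inner_add_right)
  have "(X ** sym_part (transpose X ** W)) \<bullet> V = sym_part (transpose X ** W) \<bullet> (transpose X ** V)"
    by (rule inner_matrix_mult_left)
  also have "\<dots> = sym_part (transpose X ** V) \<bullet> (transpose X ** W)"
    by (metis s inner_commute)
  also have "\<dots> = (X ** sym_part (transpose X ** V)) \<bullet> W"
    by (rule inner_matrix_mult_left[symmetric])
  finally show ?thesis by (simp add: inner_diff_left inner_diff_right inner_commute)
qed

lemma stationary_stiefel_if_penalty_stationary:
  fixes f :: "real^'p^'n \<Rightarrow> real"
  assumes lip: "locally_lipschitz f" and E: "gram_defect X = 0"
    and 0: "0 \<in> clarke_subdiff (penalty f \<beta>) X"
  shows "stationary_stiefel f X"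
proof -
  define P where "P V = V - X ** sym_part (transpose X ** V)" for V
  have dX: "dissolve X = X" by (simp add: dissolve_eq E)
  have fin: "clarke_dir_deriv f X V < \<infinity>" for V
    by (rule locally_lipschitz_clarke_finite[OF lip])
  have "linear P"
    by (rule linearI) (simp_all add: P_def sym_part_def matrix_expand algebra_simps)
  then have "subspace (range P)" by (rule linear_subspace_image) simp
  moreover have "ereal (0 \<bullet> u) \<le> clarke_dir_deriv f X u" if "u \<in> range P" for u
  proof -
    obtain V where "u = P V" using \<open>u \<in> range P\<close> by blast
    then have u: "u = dissolve_deriv X V"
      by (simp add: P_def dissolve_deriv_stiefel[OF E])
    obtain c where c: "clarke_dir_deriv f X u = ereal c"
      using clarke_dir_deriv_finite[OF fin] by blast
    \<comment> \<open>The penalty term has zero derivative because \<open>E = 0\<close>, so the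
      stationarity of \<open>penalty f \<beta>\<close> bounds the derivative of \<open>f\<close>
      along \<open>P V\<close> from below by 0.\<close>
    have "clarke_dir_deriv (penalty f \<beta>) X V \<le> ereal c"
      using clarke_dir_deriv_penalty_le[OF lip, of X V c \<beta>] c by (simp add: dX u E)
    moreover have "0 \<le> clarke_dir_deriv (penalty f \<beta>) X V"
      using 0 by (auto simp: clarke_subdiff_def zero_ereal_def)
    ultimately show ?thesis by (simp add: c) (metis ereal_less_eq(5) order_trans)
  qed
  ultimately obtain W where W: "W \<in> clarke_subdiff f X" "\<And>u. u \<in> range P \<Longrightarrow> W \<bullet> u = 0"
    using clarke_subgradient_extending[OF fin, where L = "range P" and a = 0] by auto
  \<comment> \<open>Self-adjointness moves \<open>P\<close> onto the right factor, which lies in the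
    range of \<open>P\<close>, where \<open>W\<close> vanishes.\<close>
  have "P W \<bullet> P W = W \<bullet> P (P W)"
    unfolding P_def by (rule inner_tangent_projection)
  also have "\<dots> = 0" by (rule W(2)) simp
  finally have "P W = 0" by simp
  with W(1) have "0 \<in> {W - X ** sym_part (transpose X ** W) | W. W \<in> clarke_subdiff f X}"
    unfolding P_def by force
  then show ?thesis using E by (simp add: stationary_stiefel_def stiefel_def gram_eq)
qed

theorem theorem3p10:
  fixes f :: "real^'p^'n \<Rightarrow> real" and \<beta> r :: real
  assumes "locally_lipschitz f"
    and "\<beta> > 0"
    and "r \<in> {0 <..< \<beta> / (2 * \<beta> + 8 * subgrad_bound f)}"
  shows "(\<forall>X \<in> Omega r. infdist 0 (clarke_subdiff (penalty f \<beta>) X)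
                         \<ge> \<beta> / 4 * norm (transpose X ** X - mat 1)) \<and>
         (\<forall>X \<in> Omega r. 0 \<in> clarke_subdiff (penalty f \<beta>) X \<longrightarrow> stationary_stiefel f X)"
proof -
  have ge: "\<beta> / 4 * norm (gram_defect X) \<le> norm D"
    if "X \<in> Omega r" "D \<in> clarke_subdiff (penalty f \<beta>) X" for X D
    using norm_penalty_subgradient_ge[OF assms(1,2) _ that] assms(3) by simp
  have "infdist 0 (clarke_subdiff (penalty f \<beta>) X) \<ge> \<beta> / 4 * norm (gram_defect X)"
    if "X \<in> Omega r" for X
    unfolding infdist_notempty[OF clarke_subdiff_penalty_nonempty[OF assms(1)]]
    by (rule cINF_greatest[OF clarke_subdiff_penalty_nonempty[OF assms(1)]]) (use ge[OF that] in simp)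
  moreover have "stationary_stiefel f X"
    if "X \<in> Omega r" "0 \<in> clarke_subdiff (penalty f \<beta>) X" for X
  proof (rule stationary_stiefel_if_penalty_stationary[OF assms(1) _ that(2)])
    \<comment> \<open>The lower bound is used with the subgradient \<open>D = 0\<close>.\<close>
    show "gram_defect X = 0" using ge[OF that] assms(2) by (simp add: mult_le_0_iff)
  qed
  ultimately show ?thesis by (simp add: gram_defect_def)
qed

end
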